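(* Let $\mathcal{G}$ be a graph with $n$ vertices, $m$ edges and incidence matrix $B\in\mathbb{R}^{n\times m}$, let $Q=\mathrm{diag}(q_1,\dots,q_n)$ with all $q_i>0$, let $r,d,\bar x_0,\bar x_s\in\mathbb{R}^n$ be constant vectors, let $\gamma_e,\gamma_c,\gamma_l,\gamma_p>0$, and let $L_c$ be the Laplacian matrix of a connected communication graph on the same $n$ vertices. Put $\bar x(t)=\bar x_0+\bar x_s t$, and consider the closed-loop system $$\dot x=Bu_e+u_p+d,\qquad y=x-\bar x,$$ $$\dot x_e=\gamma_e B^Ty,\qquad u_e=-\gamma_c B^Ty-\gamma_e x_e,$$ $$\dot x_p=-\gamma_l L_c x_p-\gamma_p Q^{-1}y,\qquad u_p=Q^{-1}(\gamma_p x_p-r).$$ If $\mathcal{G}$ is connected and there exists a pair of entries $q_i,q_j$ with $q_i\neq q_j$, then every solution of the closed-loop system (for any initial condition) satisfies $$\lim_{t\to\infty}\|x(t)-\bar x(t)\|=0\qquad\text{and}\qquad \lim_{t\to\infty}\|u_p(t)-\overline{u}_p\|=0,$$ where $$\overline{u}_p=-Q^{-1}\left(\frac{\mathds{1}\mathds{1}^T}{\mathds{1}^TQ^{-1}\mathds{1}}\left(d-\bar x_s-Q^{-1}r\right)+r\right).$$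
   Context: $\mathds{1}\in\mathbb{R}^n$ denotes the all-ones vector and $\|\cdot\|$ a norm on $\mathbb{R}^n$. Each edge of a graph is given a $+$ end and a $-$ end (arbitrarily if the graph is undirected); the incidence matrix $B=(b_{ik})$ has $b_{ik}=1$ if node $i$ is the $+$ end of edge $k$, $b_{ik}=-1$ if node $i$ is the $-$ end of edge $k$, and $b_{ik}=0$ otherwise. The Laplacian of a graph with incidence matrix $B$ is $L=BB^T$; in particular $L_c=B_cB_c^T$ with $B_c$ the incidence matrix of the communication graph (which need not coincide with $\mathcal{G}$). Here $x(t),x_p(t),u_p(t),y(t)\in\mathbb{R}^n$ and $x_e(t),u_e(t)\in\mathbb{R}^m$. The vector $\overline{u}_p$ is the minimizer of $s+r^Tu_p+\frac12u_p^TQu_p$ ($s\in\mathbb{R}$) over $u_p\in\mathbb{R}^n$ subject to $\mathds{1}^T(u_p+d-\bar x_s)=0$. *)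

theory Defs
  imports
    "HOL-Analysis.Analysis"
    "Graph_Theory.Digraph_Component"
begin

text \<open>
  A graph together with an arbitrary choice of end labels for its edges is represented by a
  \<^typ>\<open>('n, 'm) pre_digraph\<close>: the head of an arc is the \<open>+\<close> end of the edge and its tail the
  \<open>-\<close> end. Vertices and edges index matrices and hence exhaust their (finite) types.
  Self-loops are excluded because the incidence matrix is not well defined for them;
  parallel edges are allowed. Connectedness is \<^const>\<open>Digraph_Component.connected\<close>, which
  ignores the orientation.
\<close>

definition labelled_graph :: "('n::finite, 'm::finite) pre_digraph \<Rightarrow> bool" where
  "labelled_graph G \<longleftrightarrow> loopfree_digraph G \<and> verts G = UNIV \<and> arcs G = UNIV"

definition incidence_matrix :: "('n::finite, 'm::finite) pre_digraph \<Rightarrow> real^'m^'n" where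
  "incidence_matrix G = (\<chi> i k. if i = head G k then 1 else if i = tail G k then -1 else 0)"

definition laplacian :: "('n::finite, 'm::finite) pre_digraph \<Rightarrow> real^'n^'n" where
  "laplacian G = incidence_matrix G ** transpose (incidence_matrix G)"

definition diag :: "real^'n \<Rightarrow> real^'n^'n" where
  "diag q = (\<chi> i j. if i = j then q $ i else 0)"

definition is_norm :: "('a::real_vector \<Rightarrow> real) \<Rightarrow> bool" where
  "is_norm N \<longleftrightarrow>
     (\<forall>v. N v \<ge> 0) \<and> (\<forall>v. N v = 0 \<longleftrightarrow> v = 0) \<and>
     (\<forall>c v. N (c *\<^sub>R v) = \<bar>c\<bar> * N v) \<and> (\<forall>v w. N (v + w) \<le> N v + N w)"

definition cost :: "real \<Rightarrow> real^'n \<Rightarrow> real^'n^'n \<Rightarrow> real^'n \<Rightarrow> real" where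
  "cost s r Q u = s + r \<bullet> u + 1/2 * (u \<bullet> (Q *v u))"

text \<open>
  In the library, the vector \<^term>\<open>1 :: real^'n\<close> is the all-ones vector. The product
  of its column and row versions is the matrix \<open>1 1\<^sup>T\<close>.
\<close>

definition optimal_input :: "real^'n^'n \<Rightarrow> real^'n \<Rightarrow> real^'n \<Rightarrow> real^'n \<Rightarrow> real^'n" where
  "optimal_input Q r d xs =
     - (matrix_inv Q *v
         (((1 / (1 \<bullet> (matrix_inv Q *v 1))) *\<^sub>R
             ((columnvector 1 :: real^1^'n) ** (rowvector 1 :: real^'n^1)))
           *v (d - xs - matrix_inv Q *v r) + r))"

end

theory Submission
  imports Defs
begin

text \<open>
  The steady state has \<open>y = 0\<close>, input controllers in consensus at the value that makes \<open>u\<^sub>p\<close>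
  optimal, and edge controllers carrying a flow that balances the nodes; such a flow exists
  because \<open>G\<close> is connected (\<open>range_incidence_matrix\<close>). In the deviations \<open>(y, e, p)\<close> from it the
  closed loop becomes a homogeneous linear system \<open>z' = A z\<close> with
  \<open>z \<bullet> A z = - \<gamma>c |B\<^sup>T y|\<^sup>2 - \<gamma>l |B\<^sub>c\<^sup>T p|\<^sup>2\<close>.

  Since the dissipation is only semidefinite, an invariance argument is needed. It takes an
  elementary form here: solutions are bounded, hence so are all their derivatives, and a
  convergent function with bounded second derivative has a vanishing derivative
  (\<open>convergent_imp_derivative_tendsto_0\<close>). Applied to \<open>|z|\<^sup>2\<close>, this shows that \<open>B\<^sup>T y\<close> and
  \<open>B\<^sub>c\<^sup>T p\<close> vanish in the limit, so that, both graphs being connected, the entries of \<open>y\<close> and those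
  of \<open>p\<close> become equal. Applied to differences of entries of \<open>p\<close>, it shows that the entries of
  \<open>Q\<inverse> y\<close> become equal too. If \<open>q\<^sub>i \<noteq> q\<^sub>j\<close>, both can hold only with \<open>y \<longlonglongrightarrow> 0\<close>. Applied once more, to
  \<open>y\<close> itself, it gives \<open>y' \<longlonglongrightarrow> 0\<close>, and summing the entries of \<open>y'\<close> removes the edge terms and
  leaves \<open>p \<longlonglongrightarrow> 0\<close> (\<open>deviation_tendsto_0\<close>).

  Optimality of the limit is a separate, static fact: the cost is strictly convex, and its
  gradient at the limit is orthogonal to the constraint (\<open>cost_expansion_at_optimal_input\<close>).
\<close>

section \<open>Vanishing derivatives of convergent functions\<close>

text \<open>
  A form of Barbalat's lemma. The bound on \<open>f''\<close> makes \<open>f'\<close> nearly constant on a short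
  interval \<open>[t, t + h]\<close>, so there \<open>h f'(t)\<close> differs from the increment of \<open>f\<close>, which vanishes
  for large \<open>t\<close>, by at most \<open>M h\<^sup>2\<close>. This is what replaces an invariance principle below.
\<close>

lemma convergent_imp_derivative_tendsto_0:
  fixes f :: "real \<Rightarrow> 'a::real_normed_vector"
  assumes lim: "(f \<longlongrightarrow> l) at_top"
    and f': "\<And>t. t \<ge> 0 \<Longrightarrow> (f has_vector_derivative f' t) (at t within {0..})"
    and f'': "\<And>t. t \<ge> 0 \<Longrightarrow> (f' has_vector_derivative f'' t) (at t within {0..})"
    and bound: "\<And>t. t \<ge> 0 \<Longrightarrow> norm (f'' t) \<le> M"
  shows "(f' \<longlongrightarrow> 0) at_top"
proof (rule tendstoI)
  fix \<epsilon> :: real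
  assume \<epsilon>: "\<epsilon> > 0"
  have M: "M \<ge> 0"
    using bound[of 0] norm_ge_zero[of "f'' 0"] by linarith
  have lipschitz: "norm (f' b - f' a) \<le> M * \<bar>b - a\<bar>" if "a \<ge> 0" "b \<ge> 0" for a b
  proof -
    have "norm (f' b - f' a) \<le> M * norm (b - a)"
    proof (rule differentiable_bound)
      show "convex {0::real..}" by simp
      show "(f' has_derivative (\<lambda>h. h *\<^sub>R f'' t)) (at t within {0..})" if "t \<in> {0..}" for t
        using f''[of t] that by (simp add: has_vector_derivative_def)
      show "onorm (\<lambda>h. h *\<^sub>R f'' t) \<le> M" if "t \<in> {0..}" for t
        by (rule onorm_bound) (use bound[of t] that M in \<open>auto simp: mult.commute[of M] mult_left_mono\<close>)
    qed (use that in auto)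
    then show ?thesis by simp
  qed
  define h where "h = \<epsilon> / (2 * (M + 1))"
  have h: "h > 0"
    using \<epsilon> M by (simp add: h_def)
  have Mh: "M * h < \<epsilon> / 2"
    using \<epsilon> M by (simp add: h_def field_simps)
  have increment: "norm (f (t + h) - f t - h *\<^sub>R f' t) \<le> h * (M * h)" if "t \<ge> 0" for t
  proof -
    have "norm (f (t + h) - f t - (t + h - t) *\<^sub>R f' t) \<le> norm (t + h - t) * (M * h)"
    proof (rule vector_differentiable_bound_linearization[where S = "{t..t + h}"])
      show "(f has_vector_derivative f' s) (at s within {t..t + h})" if "s \<in> {t..t + h}" for s
        using f'[of s] that \<open>t \<ge> 0\<close> by (auto intro: has_vector_derivative_within_subset)
      show "norm (f' s - f' t) \<le> M * h" if "s \<in> {t..t + h}" for s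
      proof -
        have "norm (f' s - f' t) \<le> M * \<bar>s - t\<bar>"
          using lipschitz[of t s] that \<open>t \<ge> 0\<close> by auto
        also have "\<dots> \<le> M * h"
          using that M by (intro mult_left_mono) auto
        finally show ?thesis .
      qed
    qed (use h in \<open>auto simp: closed_segment_eq_real_ivl\<close>)
    then show ?thesis
      using h by simp
  qed
  have "filterlim (\<lambda>t. t + h) at_top at_top"
    using filterlim_tendsto_add_at_top[OF tendsto_const filterlim_ident]
    by (subst add.commute)
  then have "((\<lambda>t. f (t + h)) \<longlongrightarrow> l) at_top"
    by (rule filterlim_compose[OF lim])
  from tendsto_diff[OF this lim] have "((\<lambda>t. f (t + h) - f t) \<longlongrightarrow> 0) at_top"
    by simp
  moreover have "h * (\<epsilon> / 2) > 0"
    using h \<epsilon> by simp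
  ultimately have "eventually (\<lambda>t. norm (f (t + h) - f t) < h * (\<epsilon> / 2)) at_top"
    using tendstoD by (fastforce simp del: times_divide_eq_right)
  then show "eventually (\<lambda>t. dist (f' t) 0 < \<epsilon>) at_top"
    using eventually_ge_at_top[of 0]
  proof eventually_elim
    case (elim t)
    have "h * norm (f' t) = norm ((f (t + h) - f t) - (f (t + h) - f t - h *\<^sub>R f' t))"
      using h by simp
    also have "\<dots> \<le> norm (f (t + h) - f t) + norm (f (t + h) - f t - h *\<^sub>R f' t)"
      by (rule norm_triangle_ineq4)
    also have "\<dots> < h * (\<epsilon> / 2) + h * (M * h)"
      using elim increment[of t] by linarith
    also have "\<dots> < h * (\<epsilon> / 2) + h * (\<epsilon> / 2)"
      using mult_strict_left_mono[OF Mh h] by linarith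
    also have "\<dots> = h * \<epsilon>"
      by (simp add: field_simps)
    finally show ?case
      using h by simp
  qed
qed

text \<open>
  Along a bounded solution of \<open>z' = A z\<close>, the output \<open>C z\<close> has the bounded second derivative
  \<open>C A A z\<close>. Hence a vanishing output forces its derivative to vanish, just as for invariant
  sets inside the kernel of \<open>C\<close>.
\<close>

lemma linear_output_derivative_tendsto_0:
  fixes z :: "real \<Rightarrow> 'a::real_normed_vector"
    and C :: "'a \<Rightarrow> 'b::real_normed_vector"
  assumes A: "bounded_linear A" and C: "bounded_linear C"
    and z': "\<And>t. t \<ge> 0 \<Longrightarrow> (z has_vector_derivative A (z t)) (at t within {0..})"
    and bound: "\<And>t. t \<ge> 0 \<Longrightarrow> norm (z t) \<le> K"
    and lim: "((\<lambda>t. C (z t)) \<longlongrightarrow> 0) at_top"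
  shows "((\<lambda>t. C (A (z t))) \<longlongrightarrow> 0) at_top"
proof -
  have CA: "bounded_linear (\<lambda>v. C (A v))"
    using A C by (rule bounded_linear_compose[rotated])
  have CAA: "bounded_linear (\<lambda>v. C (A (A v)))"
    using CA A by (rule bounded_linear_compose)
  from bounded_linear.nonneg_bounded[OF CAA] obtain c
    where c: "c \<ge> 0" "\<And>v. norm (C (A (A v))) \<le> norm v * c"
    by blast
  show ?thesis
  proof (rule convergent_imp_derivative_tendsto_0[OF lim])
    fix t :: real
    assume t: "t \<ge> 0"
    show "((\<lambda>t. C (z t)) has_vector_derivative C (A (z t))) (at t within {0..})"
      by (rule bounded_linear.has_vector_derivative[OF C z'[OF t]])
    show "((\<lambda>t. C (A (z t))) has_vector_derivative C (A (A (z t)))) (at t within {0..})"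
      by (rule bounded_linear.has_vector_derivative[OF CA z'[OF t]])
    show "norm (C (A (A (z t)))) \<le> K * c"
      using c(2)[of "z t"] mult_right_mono[OF bound[OF t] c(1)] by linarith
  qed
qed

text \<open>
  For dissipative \<open>A\<close> the squared norm is a Lyapunov function: it decreases, so the solution
  stays bounded, and it converges, so its derivative \<open>2 z \<bullet> A z\<close> vanishes in the limit.
\<close>

lemma dissipative_linear_system:
  fixes z :: "real \<Rightarrow> 'a::real_inner"
  assumes A: "bounded_linear A" and dissipative: "\<And>v. v \<bullet> A v \<le> 0"
    and z': "\<And>t. t \<ge> 0 \<Longrightarrow> (z has_vector_derivative A (z t)) (at t within {0..})"
  shows bounded_dissipative_linear_system: "\<And>t. t \<ge> 0 \<Longrightarrow> norm (z t) \<le> norm (z 0)"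
    and dissipation_tendsto_0: "((\<lambda>t. z t \<bullet> A (z t)) \<longlongrightarrow> 0) at_top"
proof -
  define V where "V t = z t \<bullet> z t" for t
  have V': "(V has_vector_derivative 2 * (z t \<bullet> A (z t))) (at t within {0..})" if "t \<ge> 0" for t
    using bounded_bilinear.has_vector_derivative[OF bounded_bilinear_inner z'[OF that] z'[OF that]]
    by (simp add: V_def[abs_def] inner_commute)
  have antimono: "V b \<le> V a" if "a \<ge> 0" "a \<le> b" for a b
  proof -
    have "\<exists>t\<in>{a..b}. V b - V a = (b - a) * (2 * (z t \<bullet> A (z t)))"
    proof (rule mvt_very_simple[OF \<open>a \<le> b\<close>])
      show "(V has_derivative (\<lambda>h. h * (2 * (z t \<bullet> A (z t))))) (at t within {a..b})"
        if "a \<le> t" "t \<le> b" for t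
        using V'[of t] that \<open>a \<ge> 0\<close> unfolding has_vector_derivative_def real_scaleR_def
        by (auto intro: has_derivative_subset)
    qed
    then obtain t where "V b - V a = (b - a) * (2 * (z t \<bullet> A (z t)))"
      by blast
    moreover have "(b - a) * (2 * (z t \<bullet> A (z t))) \<le> 0"
      using \<open>a \<le> b\<close> dissipative[of "z t"] by (simp add: mult_nonneg_nonpos)
    ultimately show ?thesis
      by simp
  qed
  show bound: "norm (z t) \<le> norm (z 0)" if "t \<ge> 0" for t
    using antimono[of 0 t] that by (simp add: V_def norm_le)
  obtain c where c: "c \<ge> 0" "\<And>v. norm (A v) \<le> norm v * c"
    using bounded_linear.nonneg_bounded[OF A] by blast
  define K where "K = norm (z 0)"
  define l where "l = (INF t\<in>{0..}. V t)"
  have bdd: "bdd_below (V ` {0..})"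
    by (rule bdd_belowI[of _ 0]) (auto simp: V_def)
  have "(V \<longlongrightarrow> l) at_top"
  proof (rule order_tendstoI)
    fix a assume a: "a < l"
    show "eventually (\<lambda>t. a < V t) at_top"
      using eventually_ge_at_top[of 0]
    proof eventually_elim
      case (elim t)
      then have "l \<le> V t"
        unfolding l_def by (intro cINF_lower[OF bdd]) simp
      with a show ?case
        by simp
    qed
  next
    fix a assume "l < a"
    then obtain s where s: "s \<ge> 0" "V s < a"
      by (auto simp: l_def cINF_less_iff[OF _ bdd])
    show "eventually (\<lambda>t. V t < a) at_top"
      using eventually_ge_at_top[of s]
      by eventually_elim (use antimono[OF s(1)] s(2) in \<open>force intro: le_less_trans\<close>)
  qed
  then have "((\<lambda>t. 2 * (z t \<bullet> A (z t))) \<longlongrightarrow> 0) at_top"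
  proof (rule convergent_imp_derivative_tendsto_0[OF _ V'])
    fix t :: real
    assume t: "t \<ge> 0"
    have Az': "((\<lambda>t. A (z t)) has_vector_derivative A (A (z t))) (at t within {0..})"
      by (rule bounded_linear.has_vector_derivative[OF A z'[OF t]])
    show "((\<lambda>t. 2 * (z t \<bullet> A (z t))) has_vector_derivative
        2 * (z t \<bullet> A (A (z t)) + A (z t) \<bullet> A (z t))) (at t within {0..})"
      by (intro has_vector_derivative_mult_right
          bounded_bilinear.has_vector_derivative[OF bounded_bilinear_inner z'[OF t] Az'])
    have z: "norm (z t) \<le> K"
      using bound[OF t] by (simp add: K_def)
    have Az: "norm (A (z t)) \<le> K * c"
      using c(2)[of "z t"] mult_right_mono[OF z c(1)] by linarith
    have AAz: "norm (A (A (z t))) \<le> K * c * c"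
      using c(2)[of "A (z t)"] mult_right_mono[OF Az c(1)] by linarith
    have "norm (z t \<bullet> A (A (z t))) \<le> K * (K * c * c)"
      using Cauchy_Schwarz_ineq2[of "z t" "A (A (z t))"] mult_mono[OF z AAz]
      by (simp add: K_def)
    moreover have "norm (A (z t) \<bullet> A (z t)) \<le> K * c * (K * c)"
      using Cauchy_Schwarz_ineq2[of "A (z t)" "A (z t)"] mult_mono[OF Az Az] c(1)
      by (simp add: K_def)
    ultimately have "norm (z t \<bullet> A (A (z t)) + A (z t) \<bullet> A (z t))
        \<le> K * (K * c * c) + K * c * (K * c)"
      by (rule norm_add_rule_thm)
    then show "norm (2 * (z t \<bullet> A (A (z t)) + A (z t) \<bullet> A (z t)))
        \<le> 2 * (K * (K * c * c) + K * c * (K * c))"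
      unfolding norm_mult by simp
  qed
  from tendsto_mult_left[OF this, of "1/2"] show "((\<lambda>t. z t \<bullet> A (z t)) \<longlongrightarrow> 0) at_top"
    by simp
qed


section \<open>Incidence matrices of connected graphs\<close>

(* Products with B\<^sup>T must stay in column form for incidence_transpose_mult_nth to rewrite them. *)
declare transpose_matrix_vector [simp del]

lemma incidence_transpose_mult_nth:
  assumes "labelled_graph G"
  shows "(transpose (incidence_matrix G) *v v) $ k = v $ head G k - v $ tail G k"
proof -
  interpret loopfree_digraph G
    using assms by (simp add: labelled_graph_def)
  have "head G k \<noteq> tail G k"
    using assms no_loops[of k] by (auto simp: labelled_graph_def)
  then have "(\<Sum>i\<in>UNIV. (if i = head G k then 1 else if i = tail G k then - 1 else 0) * v $ i)
      = (\<Sum>i\<in>UNIV. (if i = head G k then v $ i else 0) - (if i = tail G k then v $ i else 0))"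
    by (intro sum.cong) auto
  then show ?thesis
    by (simp add: incidence_matrix_def matrix_vector_mult_def transpose_def sum_subtractf)
qed

text \<open>
  Every fact of the form ``both ends of an edge agree'' spreads to all vertices. It is applied
  both to equality and to asymptotic equality of components.
\<close>

lemma connected_equivp_on_arcs:
  fixes G :: "('n::finite, 'm::finite) pre_digraph"
  assumes G: "labelled_graph G" "Digraph_Component.connected G"
    and R: "equivp R" and arcs: "\<And>k. R (tail G k) (head G k)"
  shows "R i j"
proof -
  have "i \<rightarrow>\<^sup>*\<^bsub>mk_symmetric G\<^esub> j"
    using G by (auto simp: Digraph_Component.connected_def strongly_connected_def labelled_graph_def)
  then have "(i, j) \<in> rtrancl_on UNIV (parcs (mk_symmetric G))"
    using G by (simp add: reachable_def labelled_graph_def)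
  then show ?thesis
  proof (induct rule: rtrancl_on_induct)
    case base
    show ?case
      using R by (rule equivp_reflp)
  next
    case (step v w)
    then have "R v w"
      using arcs equivp_symp[OF R] by (auto simp: parcs_mk_symmetric)
    with \<open>R i v\<close> show ?case
      by (rule equivp_transp[OF R])
  qed
qed

lemma incidence_transpose_tendsto_0_imp_consensus:
  fixes G :: "('n::finite, 'm::finite) pre_digraph" and v :: "'a \<Rightarrow> real^'n"
  assumes G: "labelled_graph G" "Digraph_Component.connected G"
    and lim: "((\<lambda>t. transpose (incidence_matrix G) *v v t) \<longlongrightarrow> 0) F"
  shows "((\<lambda>t. v t $ i - v t $ j) \<longlongrightarrow> 0) F"
proof -
  define R where "R i j \<longleftrightarrow> ((\<lambda>t. v t $ i - v t $ j) \<longlongrightarrow> 0) F" for i j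
  have "R i j"
  proof (rule connected_equivp_on_arcs[OF G])
    show "equivp R"
    proof (rule equivpI)
      show "reflp R"
        by (simp add: reflp_def R_def)
      show "symp R"
        using tendsto_minus by (fastforce simp: symp_def R_def)
      show "transp R"
        using tendsto_add by (fastforce simp: transp_def R_def)
    qed
    fix k
    show "R (tail G k) (head G k)"
      using tendsto_minus[OF tendsto_vec_nth[OF lim, of k]]
      by (simp add: R_def incidence_transpose_mult_nth[OF G(1)])
  qed
  then show ?thesis
    by (simp add: R_def)
qed

lemma incidence_transpose_eq_0_imp_constant:
  fixes G :: "('n::finite, 'm::finite) pre_digraph"
  assumes G: "labelled_graph G" "Digraph_Component.connected G"
    and v: "transpose (incidence_matrix G) *v v = 0"
  shows "v $ i = v $ j"
proof -
  have "((\<lambda>t::nat. v $ i - v $ j) \<longlongrightarrow> 0) sequentially"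
    by (rule incidence_transpose_tendsto_0_imp_consensus[OF G]) (simp add: v)
  then show ?thesis
    by (simp add: LIMSEQ_const_iff)
qed

lemma incidence_transpose_mult_constant:
  assumes "labelled_graph G"
  shows "transpose (incidence_matrix G) *v (c *\<^sub>R 1) = 0"
  by (simp add: vec_eq_iff incidence_transpose_mult_nth[OF assms])

lemma inner_mult_transpose: "(A *v v) \<bullet> w = v \<bullet> (transpose A *v w)"
  for A :: "real^'m^'n"
  by (metis dot_lmul_matrix inner_commute vector_transpose_matrix transpose_transpose)

text \<open>
  The range of \<open>B\<close> is the orthogonal complement of the kernel of \<open>B\<^sup>T\<close>, which consists of the
  constant vectors. This provides the steady-state flows on the edges.
\<close>

lemma range_incidence_matrix:
  fixes G :: "('n::finite, 'm::finite) pre_digraph"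
  assumes G: "labelled_graph G" "Digraph_Component.connected G" and b: "1 \<bullet> b = 0"
  shows "\<exists>f. incidence_matrix G *v f = b"
proof -
  let ?B = "incidence_matrix G"
  have "subspace (range ((*v) ?B))"
    by (rule linear_subspace_image[OF matrix_vector_mul_linear subspace_UNIV])
  then obtain f w where b_eq: "b = ?B *v f + w" and orth: "\<And>g. orthogonal w (?B *v g)"
    using orthogonal_subspace_decomp_exists[of "range ((*v) ?B)" b]
    by (metis rangeE rangeI span_eq_iff)
  have "g \<bullet> (transpose ?B *v w) = 0" for g
    using orth[of g] by (simp add: inner_mult_transpose[symmetric] orthogonal_def inner_commute)
  then have "transpose ?B *v w = 0"
    using inner_eq_zero_iff by blast
  then have "w = (w $ undefined) *\<^sub>R 1"
    using incidence_transpose_eq_0_imp_constant[OF G] by (auto simp: vec_eq_iff)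
  then have "w \<bullet> b = 0"
    using b by (metis inner_scaleR_left mult_zero_right)
  moreover have "w \<bullet> (?B *v f) = 0"
    using orth[of f] by (simp add: orthogonal_def)
  ultimately have "w = 0"
    by (simp add: b_eq inner_add_right)
  then show ?thesis
    using b_eq by auto
qed


section \<open>Diagonal matrices and the optimal input\<close>

lemma diag_mult_nth [simp]: "(diag q *v v) $ i = q $ i * v $ i"
  by (simp add: diag_def matrix_vector_mult_def if_distrib[of "\<lambda>a. a * _"] cong: if_cong)

lemma matrix_inv_diag_mult_nth:
  fixes q :: "real^'n"
  assumes q: "\<And>i. q $ i \<noteq> 0"
  shows "(matrix_inv (diag q) *v v) $ i = v $ i / q $ i"
proof -
  have "diag q ** diag (\<chi> i. 1 / q $ i) = mat 1" "diag (\<chi> i. 1 / q $ i) ** diag q = mat 1"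
    using q by (simp_all add: matrix_eq matrix_vector_mul_assoc[symmetric] vec_eq_iff)
  then have "\<exists>A'. diag q ** A' = mat 1 \<and> A' ** diag q = mat 1"
    by blast
  from someI_ex[OF this] have "diag q ** matrix_inv (diag q) = mat 1"
    by (simp add: matrix_inv_def)
  then have "diag q *v (matrix_inv (diag q) *v v) = v"
    by (simp add: matrix_vector_mul_assoc)
  then have "q $ i * (matrix_inv (diag q) *v v) $ i = v $ i"
    by (metis diag_mult_nth)
  then show ?thesis
    using q[of i] by (simp add: field_simps)
qed

lemma inner_one_vec: "1 \<bullet> v = (\<Sum>i\<in>UNIV. v $ i)" for v :: "real^'n"
  by (simp add: inner_vec_def)

lemma column_row_mult_vec:
  "((columnvector 1 :: real^1^'n) ** (rowvector 1 :: real^'n^1)) *v v = (1 \<bullet> v) *\<^sub>R 1"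
  for v :: "real^'n"
  by (simp add: vec_eq_iff matrix_vector_mult_def matrix_matrix_mult_def columnvector_def
      rowvector_def inner_vec_def)

definition lagrange_multiplier :: "real^'n \<Rightarrow> real^'n \<Rightarrow> real^'n \<Rightarrow> real^'n \<Rightarrow> real" where
  "lagrange_multiplier q r d xs =
     (\<Sum>i\<in>UNIV. d $ i - xs $ i - r $ i / q $ i) / (\<Sum>i\<in>UNIV. 1 / q $ i)"

lemma optimal_input_nth:
  assumes "\<And>i. q $ i \<noteq> 0"
  shows "optimal_input (diag q) r d xs $ i = - ((lagrange_multiplier q r d xs + r $ i) / q $ i)"
  by (simp add: optimal_input_def lagrange_multiplier_def matrix_inv_diag_mult_nth[OF assms]
      scaleR_matrix_vector_assoc[symmetric] column_row_mult_vec inner_one_vec)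

lemma optimal_input_feasible:
  fixes q :: "real^'n"
  assumes q: "\<And>i. q $ i > 0"
  shows "1 \<bullet> (optimal_input (diag q) r d xs + d - xs) = 0"
proof -
  let ?\<kappa> = "lagrange_multiplier q r d xs"
  have q0: "q $ i \<noteq> 0" for i
    using q[of i] by simp
  have "(\<Sum>i\<in>UNIV. 1 / q $ i) > 0"
    using q by (intro sum_pos) auto
  then have "?\<kappa> * (\<Sum>i\<in>UNIV. 1 / q $ i) = (\<Sum>i\<in>UNIV. d $ i - xs $ i - r $ i / q $ i)"
    by (simp add: lagrange_multiplier_def)
  moreover have "1 \<bullet> (optimal_input (diag q) r d xs + d - xs) =
      (\<Sum>i\<in>UNIV. d $ i - xs $ i - r $ i / q $ i) - ?\<kappa> * (\<Sum>i\<in>UNIV. 1 / q $ i)"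
    by (simp add: inner_one_vec optimal_input_nth[OF q0] sum_distrib_left
        sum.distrib sum_subtractf sum_negf add_divide_distrib diff_divide_distrib)
  ultimately show ?thesis
    by simp
qed

text \<open>
  At the optimal input the gradient \<open>r + Q u\<close> equals \<open>- \<kappa>\<close> times the all-ones vector, where \<open>\<kappa>\<close>
  is the Lagrange multiplier. It is orthogonal to all feasible directions, so along the constraint
  the cost exceeds its value there by a purely quadratic term.
\<close>

lemma cost_expansion_at_optimal_input:
  fixes q r d xs v u :: "real^'n"
  assumes q: "\<And>i. q $ i > 0" and v: "1 \<bullet> (v + d - xs) = 0"
    and u: "u = optimal_input (diag q) r d xs"
  shows "cost s r (diag q) v = cost s r (diag q) u + 1/2 * (\<Sum>i\<in>UNIV. q $ i * (v $ i - u $ i)\<^sup>2)"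
proof -
  let ?\<kappa> = "lagrange_multiplier q r d xs"
  have q0: "q $ i \<noteq> 0" for i
    using q[of i] by simp
  have gradient: "r $ i + q $ i * u $ i = - ?\<kappa>" for i
    using q0[of i] by (simp add: u optimal_input_nth[OF q0])
  have "1 \<bullet> (v - u) = 1 \<bullet> (v + d - xs) - 1 \<bullet> (u + d - xs)"
    by (simp add: inner_add_right inner_diff_right)
  then have "(\<Sum>i\<in>UNIV. v $ i - u $ i) = 0"
    using v optimal_input_feasible[OF q] by (simp add: u inner_one_vec)
  then have "(\<Sum>i\<in>UNIV. (r $ i + q $ i * u $ i) * (v $ i - u $ i)) = 0"
    unfolding gradient sum_distrib_left[symmetric] by simp
  moreover have "cost s r (diag q) v = cost s r (diag q) u
      + (\<Sum>i\<in>UNIV. (r $ i + q $ i * u $ i) * (v $ i - u $ i))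
      + 1/2 * (\<Sum>i\<in>UNIV. q $ i * (v $ i - u $ i)\<^sup>2)"
  proof -
    have "(\<Sum>i\<in>UNIV. r $ i * v $ i + 1/2 * (v $ i * (q $ i * v $ i))) =
        (\<Sum>i\<in>UNIV. (r $ i * u $ i + 1/2 * (u $ i * (q $ i * u $ i)))
          + (r $ i + q $ i * u $ i) * (v $ i - u $ i) + 1/2 * (q $ i * (v $ i - u $ i)\<^sup>2))"
      by (intro sum.cong refl) (simp add: field_simps power2_eq_square)
    then show ?thesis
      by (simp only: cost_def inner_vec_def inner_real_def diag_mult_nth sum.distrib
          sum_distrib_left[of "1/2"])
  qed
  ultimately show ?thesis
    by simp
qed

lemma is_arg_min_cost_iff:
  fixes q :: "real^'n"
  assumes q: "\<And>i. q $ i > 0"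
  shows "is_arg_min (cost s r (diag q)) (\<lambda>v. 1 \<bullet> (v + d - xs) = 0) u
    \<longleftrightarrow> u = optimal_input (diag q) r d xs"
proof -
  let ?u = "optimal_input (diag q) r d xs"
  have le: "cost s r (diag q) ?u \<le> cost s r (diag q) v" if "1 \<bullet> (v + d - xs) = 0" for v
    using q by (simp add: cost_expansion_at_optimal_input[OF q that refl] sum_nonneg less_imp_le)
  have less: "cost s r (diag q) ?u < cost s r (diag q) v"
    if feasible: "1 \<bullet> (v + d - xs) = 0" and neq: "v \<noteq> ?u" for v
  proof -
    obtain j where "v $ j \<noteq> ?u $ j"
      using neq by (auto simp: vec_eq_iff)
    then have "(\<Sum>i\<in>UNIV. q $ i * (v $ i - ?u $ i)\<^sup>2) > 0"
      using q by (intro sum_pos2[of _ j]) (auto simp: less_imp_le)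
    then show ?thesis
      by (simp add: cost_expansion_at_optimal_input[OF q feasible refl])
  qed
  show ?thesis
    unfolding is_arg_min_def
    using le less optimal_input_feasible[OF q, of r d xs] by (metis not_less)
qed


section \<open>Convergence of the deviation from the steady state\<close>

text \<open>
  The state is \<open>(y, e, p)\<close>, the deviations of storage, edge and input controllers. The couplings
  through \<open>B\<close> and \<open>w\<close> are skew-symmetric, so only the damping terms
  \<open>\<gamma>c |B\<^sup>T y|\<^sup>2\<close> and \<open>\<gamma>l |B\<^sub>c\<^sup>T p|\<^sup>2\<close> dissipate, and both \<open>y\<close> and \<open>p\<close> approach consensus.
  Differentiating the consensus of \<open>p\<close> shows that the entries \<open>w\<^sub>i y\<^sub>i\<close> approach consensus as
  well; with two different weights this leaves only \<open>y \<longlonglongrightarrow> 0\<close>. Then \<open>y'\<close> vanishes too, and its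
  total, to which the edges do not contribute, gives \<open>p \<longlonglongrightarrow> 0\<close>. No limit of \<open>e\<close> is
  claimed, since a circulation of the edge states on the cycles of the graph may persist.
\<close>

lemma deviation_tendsto_0:
  fixes G :: "('n::finite, 'm::finite) pre_digraph"
    and Gc :: "('n, 'l::finite) pre_digraph"
    and w :: "real^'n" and y p :: "real \<Rightarrow> real^'n" and e :: "real \<Rightarrow> real^'m"
  assumes G: "labelled_graph G" "Digraph_Component.connected G"
    and Gc: "labelled_graph Gc" "Digraph_Component.connected Gc"
    and w: "\<And>i. w $ i > 0" and distinct_weights: "\<exists>i j. w $ i \<noteq> w $ j"
    and gains: "\<gamma>c > 0" "\<gamma>l > 0" "\<gamma>p > 0"
    and y': "\<And>t. t \<ge> 0 \<Longrightarrow> (y has_vector_derivative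
        - (\<gamma>c *\<^sub>R (laplacian G *v y t)) - \<gamma>e *\<^sub>R (incidence_matrix G *v e t)
        + \<gamma>p *\<^sub>R (diag w *v p t)) (at t within {0..})"
    and e': "\<And>t. t \<ge> 0 \<Longrightarrow> (e has_vector_derivative
        \<gamma>e *\<^sub>R (transpose (incidence_matrix G) *v y t)) (at t within {0..})"
    and p': "\<And>t. t \<ge> 0 \<Longrightarrow> (p has_vector_derivative
        - (\<gamma>l *\<^sub>R (laplacian Gc *v p t)) - \<gamma>p *\<^sub>R (diag w *v y t)) (at t within {0..})"
  shows "(y \<longlongrightarrow> 0) at_top" and "(p \<longlongrightarrow> 0) at_top"
proof -
  let ?B = "incidence_matrix G" and ?Bc = "incidence_matrix Gc"
  define A :: "(real^'n) \<times> (real^'m) \<times> (real^'n) \<Rightarrow> (real^'n) \<times> (real^'m) \<times> (real^'n)"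
    where "A v = (- (\<gamma>c *\<^sub>R (laplacian G *v fst v)) - \<gamma>e *\<^sub>R (?B *v fst (snd v))
          + \<gamma>p *\<^sub>R (diag w *v snd (snd v)),
        \<gamma>e *\<^sub>R (transpose ?B *v fst v),
        - (\<gamma>l *\<^sub>R (laplacian Gc *v snd (snd v))) - \<gamma>p *\<^sub>R (diag w *v fst v))" for v
  define z where "z t = (y t, e t, p t)" for t
  have fst_z: "bounded_linear (\<lambda>v::(real^'n) \<times> (real^'m) \<times> (real^'n). fst v)"
    and mid_z: "bounded_linear (\<lambda>v::(real^'n) \<times> (real^'m) \<times> (real^'n). fst (snd v))"
    and last_z: "bounded_linear (\<lambda>v::(real^'n) \<times> (real^'m) \<times> (real^'n). snd (snd v))"
    by (intro bounded_linear_fst bounded_linear_fst_comp bounded_linear_snd_comp bounded_linear_snd)+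
  have A: "bounded_linear A"
    unfolding A_def[abs_def]
    by (intro bounded_linear_Pair bounded_linear_add bounded_linear_sub bounded_linear_minus
        bounded_linear_const_scaleR
        bounded_linear_compose[OF matrix_vector_mul_bounded_linear] fst_z mid_z last_z)
  have z': "(z has_vector_derivative A (z t)) (at t within {0..})" if "t \<ge> 0" for t
    unfolding z_def[abs_def] A_def fst_conv snd_conv
    by (intro has_vector_derivative_Pair y' e' p' that)
  have diag_sym: "a \<bullet> (diag w *v b) = b \<bullet> (diag w *v a)" for a b
    by (simp add: inner_vec_def mult.commute mult.left_commute)
  have B_adjoint: "a \<bullet> (?B *v f) = f \<bullet> (transpose ?B *v a)" for a f
    by (simp add: inner_mult_transpose[symmetric] inner_commute)
  have lap: "a \<bullet> (laplacian H *v a) = (norm (transpose (incidence_matrix H) *v a))\<^sup>2"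
    for H :: "('n, 'k::finite) pre_digraph" and a
    by (simp add: laplacian_def matrix_vector_mul_assoc[symmetric] power2_norm_eq_inner
        inner_mult_transpose[symmetric] inner_commute)
  have dissipation: "v \<bullet> A v = - (\<gamma>c * (norm (transpose ?B *v fst v))\<^sup>2)
      - \<gamma>l * (norm (transpose ?Bc *v snd (snd v)))\<^sup>2" for v
    by (cases v) (simp add: A_def inner_add_right inner_diff_right lap
        B_adjoint diag_sym)
  have dissipative: "v \<bullet> A v \<le> 0" for v
  proof -
    have "0 \<le> \<gamma>c * (norm (transpose ?B *v fst v))\<^sup>2"
      "0 \<le> \<gamma>l * (norm (transpose ?Bc *v snd (snd v)))\<^sup>2"
      using gains by simp_all
    then show ?thesis
      unfolding dissipation by linarith
  qed
  note bounded = bounded_dissipative_linear_system[OF A dissipative z']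
  note output_derivative = linear_output_derivative_tendsto_0[OF A _ z' bounded]
  have damping: "((\<lambda>t. \<gamma>c * (norm (transpose ?B *v y t))\<^sup>2
      + \<gamma>l * (norm (transpose ?Bc *v p t))\<^sup>2) \<longlongrightarrow> 0) at_top"
    using tendsto_minus[OF dissipation_tendsto_0[OF A dissipative z']]
    by (simp add: dissipation z_def add.commute)
  have vanish: "(f \<longlongrightarrow> 0) at_top"
    if "c > 0" "\<And>t. c * (norm (f t))\<^sup>2 \<le> \<gamma>c * (norm (transpose ?B *v y t))\<^sup>2
      + \<gamma>l * (norm (transpose ?Bc *v p t))\<^sup>2"
    for c and f :: "real \<Rightarrow> real^'k"
  proof -
    have "((\<lambda>t. c * (norm (f t))\<^sup>2) \<longlongrightarrow> 0) at_top"
      by (rule tendsto_sandwich[OF _ _ tendsto_const damping]) (use that in auto)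
    from tendsto_real_sqrt[OF tendsto_mult_left[OF this, of "1 / c"]]
    have "((\<lambda>t. norm (f t)) \<longlongrightarrow> 0) at_top"
      using \<open>c > 0\<close> by simp
    then show ?thesis
      by (rule tendsto_norm_zero_cancel)
  qed
  have By: "((\<lambda>t. transpose ?B *v y t) \<longlongrightarrow> 0) at_top"
    by (rule vanish[of \<gamma>c]) (use gains in auto)
  have Bcp: "((\<lambda>t. transpose ?Bc *v p t) \<longlongrightarrow> 0) at_top"
    by (rule vanish[of \<gamma>l]) (use gains in auto)
  have y_consensus: "((\<lambda>t. y t $ i - y t $ j) \<longlongrightarrow> 0) at_top" for i j
    by (rule incidence_transpose_tendsto_0_imp_consensus[OF G By])
  have p_consensus: "((\<lambda>t. p t $ i - p t $ j) \<longlongrightarrow> 0) at_top" for i j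
    by (rule incidence_transpose_tendsto_0_imp_consensus[OF Gc Bcp])

  have Lp: "((\<lambda>t. laplacian Gc *v p t) \<longlongrightarrow> 0) at_top"
    using bounded_linear.tendsto_zero[OF matrix_vector_mul_bounded_linear Bcp, of ?Bc]
    by (simp add: laplacian_def matrix_vector_mul_assoc)
  have wy_consensus: "((\<lambda>t. w $ i * y t $ i - w $ j * y t $ j) \<longlongrightarrow> 0) at_top" for i j
  proof -
    have "bounded_linear (\<lambda>v::(real^'n) \<times> (real^'m) \<times> (real^'n). snd (snd v) $ i - snd (snd v) $ j)"
      by (intro bounded_linear_sub bounded_linear_compose[OF bounded_linear_vec_nth last_z])
    from output_derivative[OF this] have "((\<lambda>t. snd (snd (A (z t))) $ i - snd (snd (A (z t))) $ j) \<longlongrightarrow> 0) at_top"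
      using p_consensus by (simp add: z_def)
    from tendsto_add[OF this tendsto_mult_left[OF
        tendsto_diff[OF tendsto_vec_nth[OF Lp, of i] tendsto_vec_nth[OF Lp, of j]], of \<gamma>l]]
    have "((\<lambda>t. \<gamma>p * (w $ j * y t $ j - w $ i * y t $ i)) \<longlongrightarrow> 0) at_top"
      by (simp add: A_def z_def algebra_simps)
    from tendsto_mult_left[OF this, of "- 1 / \<gamma>p"] show ?thesis
      using gains by (simp add: algebra_simps)
  qed

  obtain i j where ij: "w $ i \<noteq> w $ j"
    using distinct_weights by blast
  have "((\<lambda>t. (w $ i * y t $ i - w $ j * y t $ j) - w $ j * (y t $ i - y t $ j)) \<longlongrightarrow> 0) at_top"
    using tendsto_diff[OF wy_consensus[of i j] tendsto_mult_left[OF y_consensus[of i j], of "w $ j"]]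
    by simp
  then have "((\<lambda>t. (w $ i - w $ j) * y t $ i) \<longlongrightarrow> 0) at_top"
    by (simp add: algebra_simps)
  from tendsto_mult_left[OF this, of "1 / (w $ i - w $ j)"]
  have yi: "((\<lambda>t. y t $ i) \<longlongrightarrow> 0) at_top"
    using ij by simp
  have "((\<lambda>t. y t $ k) \<longlongrightarrow> 0) at_top" for k
    using tendsto_add[OF yi y_consensus[of k i]] by simp
  then show y: "(y \<longlongrightarrow> 0) at_top"
    by (intro vec_tendstoI) simp

  have "((\<lambda>t. fst (A (z t))) \<longlongrightarrow> 0) at_top"
  proof (rule output_derivative[OF fst_z])
    show "((\<lambda>t. fst (z t)) \<longlongrightarrow> 0) at_top"
      unfolding z_def fst_conv by (rule y)
  qed
  then have "((\<lambda>t. 1 \<bullet> fst (A (z t))) \<longlongrightarrow> 0) at_top"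
    using tendsto_inner[OF tendsto_const] by fastforce
  moreover have edges: "1 \<bullet> (?B *v f) = 0" for f
    using incidence_transpose_mult_constant[OF G(1), of 1]
    by (metis inner_commute inner_mult_transpose inner_zero_right scaleR_one)
  moreover have "1 \<bullet> (laplacian G *v v) = 0" for v
    using edges by (simp add: laplacian_def matrix_vector_mul_assoc[symmetric])
  ultimately have "((\<lambda>t. \<gamma>p * (\<Sum>i\<in>UNIV. w $ i * p t $ i)) \<longlongrightarrow> 0) at_top"
    by (simp add: A_def z_def inner_add_right inner_diff_right inner_one_vec)
  from tendsto_mult_left[OF this, of "1 / \<gamma>p"]
  have total: "((\<lambda>t. \<Sum>i\<in>UNIV. w $ i * p t $ i) \<longlongrightarrow> 0) at_top"
    using gains by simp
  have W: "(\<Sum>i\<in>UNIV. w $ i) > 0"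
    using w by (intro sum_pos) auto
  have "((\<lambda>t. p t $ k) \<longlongrightarrow> 0) at_top" for k
  proof -
    have "((\<lambda>t. \<Sum>i\<in>UNIV. w $ i * (p t $ i - p t $ k)) \<longlongrightarrow> 0) at_top"
      using p_consensus by (intro tendsto_null_sum tendsto_mult_right_zero) auto
    moreover have "(\<Sum>i\<in>UNIV. w $ i * p t $ i) - (\<Sum>i\<in>UNIV. w $ i * (p t $ i - p t $ k))
        = (\<Sum>i\<in>UNIV. w $ i) * p t $ k" for t
      by (simp add: right_diff_distrib sum_subtractf sum_distrib_right)
    ultimately have "((\<lambda>t. (\<Sum>i\<in>UNIV. w $ i) * p t $ k) \<longlongrightarrow> 0) at_top"
      using tendsto_diff[OF total] by fastforce
    from tendsto_mult_left[OF this, of "1 / (\<Sum>i\<in>UNIV. w $ i)"] show ?thesis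
      using W by simp
  qed
  then show "(p \<longlongrightarrow> 0) at_top"
    by (intro vec_tendstoI) simp
qed

text \<open>
  By the triangle inequality over the standard basis, \<open>N v \<le> (\<Sum>i. |v\<^sub>i| N e\<^sub>i)\<close>.
\<close>

lemma is_norm_tendsto_0:
  fixes N :: "real^'n \<Rightarrow> real"
  assumes N: "is_norm N" and f: "(f \<longlongrightarrow> 0) F"
  shows "((\<lambda>t. N (f t)) \<longlongrightarrow> 0) F"
proof (rule tendsto_sandwich[OF _ _ tendsto_const])
  have sub: "N (\<Sum>i\<in>I. g i) \<le> (\<Sum>i\<in>I. N (g i))" if "finite I" for I and g :: "'n \<Rightarrow> real^'n"
    using that
  proof induct
    case empty
    then show ?case
      using N unfolding is_norm_def by (metis order_refl sum.empty)
  next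
    case (insert i I)
    have "N (g i + (\<Sum>i\<in>I. g i)) \<le> N (g i) + N (\<Sum>i\<in>I. g i)"
      using N by (auto simp: is_norm_def)
    with insert show ?case
      by simp
  qed
  have "N v \<le> (\<Sum>i\<in>UNIV. \<bar>v $ i\<bar> * N (axis i 1))" for v
  proof -
    have "N v = N (\<Sum>i\<in>UNIV. v $ i *\<^sub>R axis i 1)"
      by (simp add: basis_expansion[of v, unfolded scalar_mult_eq_scaleR])
    also have "\<dots> \<le> (\<Sum>i\<in>UNIV. N (v $ i *\<^sub>R axis i 1))"
      by (rule sub) simp
    also have "\<dots> = (\<Sum>i\<in>UNIV. \<bar>v $ i\<bar> * N (axis i 1))"
      using N by (simp add: is_norm_def)
    finally show ?thesis .
  qed
  then show "eventually (\<lambda>t. N (f t) \<le> (\<Sum>i\<in>UNIV. \<bar>f t $ i\<bar> * N (axis i 1))) F"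
    by simp
  show "((\<lambda>t. \<Sum>i\<in>UNIV. \<bar>f t $ i\<bar> * N (axis i 1)) \<longlongrightarrow> 0) F"
    using tendsto_vec_nth[OF f] by (intro tendsto_null_sum tendsto_mult_left_zero tendsto_rabs_zero) simp
  show "eventually (\<lambda>t. 0 \<le> N (f t)) F"
    using N by (simp add: is_norm_def)
qed


section \<open>The closed loop\<close>

theorem theorem1:
  fixes G :: "('n::finite, 'm::finite) pre_digraph"
    and Gc :: "('n, 'l::finite) pre_digraph"
    and B :: "real^'m^'n"
    and Q Lc :: "real^'n^'n"
    and q r d xbar0 xbars ubar :: "real^'n"
    and s \<gamma>e \<gamma>c \<gamma>l \<gamma>p :: real
    and N :: "real^'n \<Rightarrow> real"
    and xbar x xp y up :: "real \<Rightarrow> real^'n"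
    and xe ue :: "real \<Rightarrow> real^'m"
  assumes "labelled_graph G" and "Digraph_Component.connected G"
    and "B = incidence_matrix G"
    and "labelled_graph Gc" and "Digraph_Component.connected Gc"
    and "Lc = laplacian Gc"
    and "\<And>i. q $ i > 0" and "\<exists>i j. q $ i \<noteq> q $ j"
    and "Q = diag q"
    and "\<gamma>e > 0" and "\<gamma>c > 0" and "\<gamma>l > 0" and "\<gamma>p > 0"
    and "is_norm N"
    and "\<And>t. xbar t = xbar0 + t *\<^sub>R xbars"
    and "\<And>t. t \<ge> 0 \<Longrightarrow> (x has_vector_derivative (B *v ue t + up t + d)) (at t within {0..})"
    and "\<And>t. t \<ge> 0 \<Longrightarrow> y t = x t - xbar t"
    and "\<And>t. t \<ge> 0 \<Longrightarrow>
           (xe has_vector_derivative (\<gamma>e *\<^sub>R (transpose B *v y t))) (at t within {0..})"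
    and "\<And>t. t \<ge> 0 \<Longrightarrow> ue t = - (\<gamma>c *\<^sub>R (transpose B *v y t)) - \<gamma>e *\<^sub>R xe t"
    and "\<And>t. t \<ge> 0 \<Longrightarrow>
           (xp has_vector_derivative
              (- (\<gamma>l *\<^sub>R (Lc *v xp t)) - \<gamma>p *\<^sub>R (matrix_inv Q *v y t))) (at t within {0..})"
    and "\<And>t. t \<ge> 0 \<Longrightarrow> up t = matrix_inv Q *v (\<gamma>p *\<^sub>R xp t - r)"
    and "ubar = optimal_input Q r d xbars"
  shows "((\<lambda>t. N (x t - xbar t)) \<longlongrightarrow> 0) at_top \<and>
         ((\<lambda>t. N (up t - ubar)) \<longlongrightarrow> 0) at_top \<and>
         (\<forall>u. is_arg_min (cost s r Q) (\<lambda>v. 1 \<bullet> (v + d - xbars) = 0) u \<longleftrightarrow> u = ubar)"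
proof (intro conjI allI)
  note G = assms(1,2) and Gc = assms(4,5) and B = assms(3) and Lc = assms(6)
    and q = assms(7) and Q = assms(9) and gains = assms(10-13) and ubar = assms(22)
  have q0: "q $ i \<noteq> 0" for i
    using q[of i] by simp
  define w :: "real^'n" where "w = (\<chi> i. 1 / q $ i)"
  have inv: "matrix_inv Q *v v = diag w *v v" for v
    by (simp add: vec_eq_iff Q matrix_inv_diag_mult_nth[OF q0] w_def)
  define \<kappa> where "\<kappa> = lagrange_multiplier q r d xbars"
  have "1 \<bullet> (ubar + d - xbars) = 0"
    using optimal_input_feasible[OF q] by (simp add: ubar Q)
  then obtain f where f: "B *v f = ubar + d - xbars"
    using range_incidence_matrix[OF G] B by blast
  \<comment> \<open>The steady state: the edges carry the flow \<open>- f\<close>, and all input controllers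
      agree on the value \<open>- \<kappa> / \<gamma>p\<close>, which makes \<open>u\<^sub>p\<close> optimal.\<close>
  define e where "e t = xe t - (1 / \<gamma>e) *\<^sub>R f" for t
  define p where "p t = xp t + (\<kappa> / \<gamma>p) *\<^sub>R 1" for t
  have up: "up t = ubar + \<gamma>p *\<^sub>R (diag w *v p t)" if "t \<ge> 0" for t
  proof -
    have "up t $ i = (ubar + \<gamma>p *\<^sub>R (diag w *v p t)) $ i" for i
      using gains assms(21)[OF that, unfolded inv] q0[of i]
      by (simp add: ubar Q optimal_input_nth[OF q0] p_def w_def \<kappa>_def field_simps)
    then show ?thesis
      by (simp add: vec_eq_iff)
  qed
  have edge_flow: "B *v ue t = - (\<gamma>c *\<^sub>R (laplacian G *v y t)) - \<gamma>e *\<^sub>R (incidence_matrix G *v e t)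
      - (ubar + d - xbars)" if "t \<ge> 0" for t
    using gains f
    by (simp add: assms(19)[OF that] e_def laplacian_def B[symmetric] matrix_vector_mul_assoc[symmetric]
        matrix_vector_mult_diff_distrib matrix_vector_mult_scaleR vec.neg algebra_simps)
  have y': "(y has_vector_derivative - (\<gamma>c *\<^sub>R (laplacian G *v y t))
      - \<gamma>e *\<^sub>R (incidence_matrix G *v e t) + \<gamma>p *\<^sub>R (diag w *v p t)) (at t within {0..})"
    if "t \<ge> 0" for t
  proof (rule has_vector_derivative_transform[where f = "\<lambda>t. x t - (xbar0 + t *\<^sub>R xbars)"])
    have "((\<lambda>t. x t - (xbar0 + t *\<^sub>R xbars)) has_vector_derivative
        B *v ue t + up t + d - (0 + 1 *\<^sub>R xbars)) (at t within {0..})"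
      by (intro has_vector_derivative_diff has_vector_derivative_add has_vector_derivative_const
          assms(16) that bounded_linear.has_vector_derivative[OF bounded_linear_scaleR_left]
          has_vector_derivative_id)
    then show "((\<lambda>t. x t - (xbar0 + t *\<^sub>R xbars)) has_vector_derivative
        - (\<gamma>c *\<^sub>R (laplacian G *v y t)) - \<gamma>e *\<^sub>R (incidence_matrix G *v e t)
        + \<gamma>p *\<^sub>R (diag w *v p t)) (at t within {0..})"
      by (simp add: edge_flow[OF that] up[OF that] algebra_simps)
  qed (use that assms(15,17) in auto)
  have e': "(e has_vector_derivative \<gamma>e *\<^sub>R (transpose (incidence_matrix G) *v y t)) (at t within {0..})"
    if "t \<ge> 0" for t
    using has_vector_derivative_diff[OF assms(18)[OF that] has_vector_derivative_const]
    by (simp add: e_def[abs_def] B)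
  have "laplacian Gc *v xp t = laplacian Gc *v p t" for t
    by (simp add: p_def laplacian_def matrix_vector_mul_assoc[symmetric] matrix_vector_right_distrib
        incidence_transpose_mult_constant[OF Gc(1)])
  then have p': "(p has_vector_derivative - (\<gamma>l *\<^sub>R (laplacian Gc *v p t)) - \<gamma>p *\<^sub>R (diag w *v y t))
      (at t within {0..})" if "t \<ge> 0" for t
    using has_vector_derivative_add[OF assms(20)[OF that] has_vector_derivative_const]
    by (simp add: p_def[abs_def] Lc inv)
  have w: "\<And>i. w $ i > 0" "\<exists>i j. w $ i \<noteq> w $ j"
    using q assms(8) by (auto simp: w_def)
  note lim = deviation_tendsto_0[OF G Gc w gains(2-4) y' e' p']
  have "((\<lambda>t. N (y t)) \<longlongrightarrow> 0) at_top"
    by (rule is_norm_tendsto_0[OF assms(14) lim(1)])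
  then show "((\<lambda>t. N (x t - xbar t)) \<longlongrightarrow> 0) at_top"
    by (rule Lim_transform_eventually)
      (use eventually_ge_at_top[of 0] in eventually_elim, simp add: assms(17))
  have "((\<lambda>t. \<gamma>p *\<^sub>R (diag w *v p t)) \<longlongrightarrow> 0) at_top"
    using tendsto_scaleR[OF tendsto_const bounded_linear.tendsto_zero[OF
        matrix_vector_mul_bounded_linear lim(2)]] by fastforce
  then have "((\<lambda>t. N (\<gamma>p *\<^sub>R (diag w *v p t))) \<longlongrightarrow> 0) at_top"
    by (rule is_norm_tendsto_0[OF assms(14)])
  then show "((\<lambda>t. N (up t - ubar)) \<longlongrightarrow> 0) at_top"
    by (rule Lim_transform_eventually)
      (use eventually_ge_at_top[of 0] in eventually_elim, simp add: up)
  show "is_arg_min (cost s r Q) (\<lambda>v. 1 \<bullet> (v + d - xbars) = 0) u \<longleftrightarrow> u = ubar" for u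
    unfolding Q ubar by (rule is_arg_min_cost_iff[OF q])
qed

end
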